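(* Let $B$ be a nilpotent left semi-brace such that $E$ is an ideal of $B$. Then $B$ is right nilpotent. Moreover, if $(G,+)$ is a finite nilpotent group, then $B$ is left nilpotent.
   Context: A left semi-brace is a set $B$ with two operations $+$ and $\circ$ such that $(B,+)$ is a left cancellative semigroup (not necessarily commutative), $(B,\circ)$ is a group, and $a\circ(b+c)=a\circ b+a\circ(a^-+c)$ for all $a,b,c\in B$, where $a^-$ is the inverse of $a$ in $(B,\circ)$ and $\circ$ has higher precedence than $+$. The identity of $(B,\circ)$ is denoted $0$; it is an idempotent and a left identity of $(B,+)$. Let $E$ be the set of idempotents of $(B,+)$ and $G=B+0=\{b+0: b\in B\}$, which is a subgroup of $(B,+)$ (with identity $0$). For $a,b\in B$ put $\lambda_a(b)=a\circ(a^-+b)$, $\rho_b(a)=(a^-+b)^-\circ b$, and define the operation $a\cdot b=\lambda_a(a^-)+a\circ b+\lambda_b(b^-)$; one has $a\cdot b\in G$. For subsets $X,Y\subseteq B$, $X\cdot Y$ denotes the subgroup of $(G,+)$ generated by all $x\cdot y$ with $x\in X$, $y\in Y$, and $X+Y=\{x+y:x\in X,y\in Y\}$. A subsemigroup $I$ of $(B,+)$ is an ideal of $B$ if: (i) $I$ is a normal subgroup of $(B,\circ)$; (ii) $I\cap G$ is a normal subgroup of $(G,+)$; (iii) $\rho_b(n)\in I$ for all $b\in B$, $n\in I\cap G$; (iv) $\lambda_g(e)\in I$ for all $g\in G$, $e\in I\cap E$. For an ideal $I$, $B/I$ is the quotient group $(B,\circ)/I$ with the induced addition (which is well defined); it is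 a left semi-brace. The socle of a left semi-brace $B$ is the ideal $\operatorname{Soc}(B)=\{a\in B:\rho_a=\rho_0,\ \lambda_a=\lambda_0\}$. The socle series is $\operatorname{Soc}_0(B)=\{0\}$, $\operatorname{Soc}_1(B)=\operatorname{Soc}(B)$ and, for $k>1$, $\operatorname{Soc}_k(B)$ is the ideal of $B$ containing $\operatorname{Soc}_{k-1}(B)$ such that $\operatorname{Soc}_k(B)/\operatorname{Soc}_{k-1}(B)=\operatorname{Soc}(B/\operatorname{Soc}_{k-1}(B))$. Let $\zeta_k(B)$ be the $k$-th center of the group $(B,\circ)$ (the $k$-th term of its upper central series, $\zeta_1(B)$ being the centre). For every positive integer $k$ put $\operatorname{Ann}_k(B)=(\operatorname{Soc}_k(B)\cap\zeta_k(B))+(E\cap\zeta_k(B))$. The left semi-brace $B$ is nilpotent if $\operatorname{Ann}_n(B)=B$ for some positive integer $n$. The right series of $B$ is $B^{(1)}=B$, $B^{(n+1)}=B^{(n)}\cdot B+E$ for $n\ge1$; $B$ is right nilpotent if $B^{(n)}=E$ for some positive integer $n$. The left series of $B$ is $B^1=B$, $B^{n+1}=B\cdot B^n+E$ for $n\ge1$; $B$ is left nilpotent if $B^n=E$ for some positive integer $n$. *)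

theory Defs
  imports "HOL-Algebra.Generated_Groups"
begin

section \<open>Upper central series of a group\<close>

definition group_center :: "('a, 'b) monoid_scheme \<Rightarrow> 'a set" where
  "group_center G = {x \<in> carrier G. \<forall>y \<in> carrier G. x \<otimes>\<^bsub>G\<^esub> y = y \<otimes>\<^bsub>G\<^esub> x}"

primrec upper_central :: "('a, 'b) monoid_scheme \<Rightarrow> nat \<Rightarrow> 'a set" where
  "upper_central G 0 = {\<one>\<^bsub>G\<^esub>}"
| "upper_central G (Suc k) =
     {x \<in> carrier G. upper_central G k #>\<^bsub>G\<^esub> x \<in> group_center (G Mod upper_central G k)}"

definition nilpotent_group :: "('a, 'b) monoid_scheme \<Rightarrow> bool" where
  "nilpotent_group G \<longleftrightarrow> group G \<and> (\<exists>k. upper_central G k = carrier G)"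

lemma (in group) upper_central_1: "upper_central G 1 = group_center G"
proof -
  have singleton_coset: "{\<one>} #> x = {x}" if "x \<in> carrier G" for x
    using that by (simp add: r_coset_def)
  have "carrier (G Mod {\<one>}) = (\<lambda>x. {x}) ` carrier G"
    using singleton_coset by (auto simp: carrier_FactGroup)
  moreover have "mult (G Mod {\<one>}) {x} {y} = {x \<otimes> y}" for x y
    by (simp add: FactGroup_def set_mult_def)
  ultimately show ?thesis
    by (auto simp: group_center_def singleton_coset)
qed


section \<open>Left semi-braces\<close>

text \<open>
  The monoid part of the record is the group \<open>(B, \<circ>)\<close>, so \<open>\<otimes>\<close> is \<open>\<circ>\<close>, \<open>inv a\<close> is \<open>a\<^sup>-\<close>, and
  \<open>\<one>\<close> is the element written \<open>0\<close> in the literature; \<open>\<boxplus>\<close> is the semi-brace addition.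
\<close>

record 'a semi_brace = "'a monoid" +
  splus :: "['a, 'a] \<Rightarrow> 'a" (infixl \<open>\<boxplus>\<index>\<close> 65)

locale left_semi_brace = group B for B (structure) +
  assumes splus_closed: "\<lbrakk>a \<in> carrier B; b \<in> carrier B\<rbrakk> \<Longrightarrow> a \<boxplus> b \<in> carrier B"
    and splus_assoc: "\<lbrakk>a \<in> carrier B; b \<in> carrier B; c \<in> carrier B\<rbrakk>
          \<Longrightarrow> (a \<boxplus> b) \<boxplus> c = a \<boxplus> (b \<boxplus> c)"
    and splus_left_cancel: "\<lbrakk>a \<in> carrier B; b \<in> carrier B; c \<in> carrier B; a \<boxplus> b = a \<boxplus> c\<rbrakk>
          \<Longrightarrow> b = c"
    and semi_brace_distrib: "\<lbrakk>a \<in> carrier B; b \<in> carrier B; c \<in> carrier B\<rbrakk>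
          \<Longrightarrow> a \<otimes> (b \<boxplus> c) = a \<otimes> b \<boxplus> a \<otimes> (inv a \<boxplus> c)"

definition idem :: "('a, 'b) semi_brace_scheme \<Rightarrow> 'a set" where
  "idem B = {e \<in> carrier B. e \<boxplus>\<^bsub>B\<^esub> e = e}"

definition set_splus :: "('a, 'b) semi_brace_scheme \<Rightarrow> 'a set \<Rightarrow> 'a set \<Rightarrow> 'a set" where
  "set_splus B X Y = {x \<boxplus>\<^bsub>B\<^esub> y | x y. x \<in> X \<and> y \<in> Y}"

definition add_group :: "('a, 'b) semi_brace_scheme \<Rightarrow> 'a monoid" where
  "add_group B = \<lparr>carrier = {b \<boxplus>\<^bsub>B\<^esub> \<one>\<^bsub>B\<^esub> | b. b \<in> carrier B}, mult = splus B, one = \<one>\<^bsub>B\<^esub>\<rparr>"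

definition lam :: "('a, 'b) semi_brace_scheme \<Rightarrow> 'a \<Rightarrow> 'a \<Rightarrow> 'a" where
  "lam B a b = a \<otimes>\<^bsub>B\<^esub> (inv\<^bsub>B\<^esub> a \<boxplus>\<^bsub>B\<^esub> b)"

definition rho :: "('a, 'b) semi_brace_scheme \<Rightarrow> 'a \<Rightarrow> 'a \<Rightarrow> 'a" where
  "rho B b a = inv\<^bsub>B\<^esub> (inv\<^bsub>B\<^esub> a \<boxplus>\<^bsub>B\<^esub> b) \<otimes>\<^bsub>B\<^esub> b"

definition dot :: "('a, 'b) semi_brace_scheme \<Rightarrow> 'a \<Rightarrow> 'a \<Rightarrow> 'a" where
  "dot B a b = lam B a (inv\<^bsub>B\<^esub> a) \<boxplus>\<^bsub>B\<^esub> a \<otimes>\<^bsub>B\<^esub> b \<boxplus>\<^bsub>B\<^esub> lam B b (inv\<^bsub>B\<^esub> b)"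

definition set_dot :: "('a, 'b) semi_brace_scheme \<Rightarrow> 'a set \<Rightarrow> 'a set \<Rightarrow> 'a set" where
  "set_dot B X Y = generate (add_group B) {dot B x y | x y. x \<in> X \<and> y \<in> Y}"


section \<open>Ideals, quotients and the socle series\<close>

definition semi_brace_ideal :: "'a set \<Rightarrow> ('a, 'b) semi_brace_scheme \<Rightarrow> bool" where
  "semi_brace_ideal I B \<longleftrightarrow>
     (\<forall>x \<in> I. \<forall>y \<in> I. x \<boxplus>\<^bsub>B\<^esub> y \<in> I) \<and>
     I \<lhd> B \<and>
     (I \<inter> carrier (add_group B)) \<lhd> add_group B \<and>
     (\<forall>b \<in> carrier B. \<forall>n \<in> I \<inter> carrier (add_group B). rho B b n \<in> I) \<and>
     (\<forall>g \<in> carrier (add_group B). \<forall>e \<in> I \<inter> idem B. lam B g e \<in> I)"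

text \<open>
  The monoid part is \<open>B Mod I\<close>. The sum of two cosets is the union of the cosets of all sums of
  representatives. For an ideal \<open>I\<close> these cosets coincide, so it is the induced addition. (The
  elementwise sum of two cosets is contained in that coset, but no claim is made that it fills it.)
\<close>

definition quot_semi_brace :: "('a, 'b) semi_brace_scheme \<Rightarrow> 'a set \<Rightarrow> 'a set semi_brace" where
  "quot_semi_brace B I =
     \<lparr>carrier = carrier (B Mod I), mult = mult (B Mod I), one = one (B Mod I),
      splus = (\<lambda>X Y. \<Union>x\<in>X. \<Union>y\<in>Y. I #>\<^bsub>B\<^esub> (x \<boxplus>\<^bsub>B\<^esub> y))\<rparr>"

definition socle :: "('a, 'b) semi_brace_scheme \<Rightarrow> 'a set" where
  "socle B = {a \<in> carrier B. \<forall>b \<in> carrier B.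
     rho B a b = rho B \<one>\<^bsub>B\<^esub> b \<and> lam B a b = lam B \<one>\<^bsub>B\<^esub> b}"

text \<open>
  The ideal \<open>J\<close> containing \<open>Soc\<^sub>k\<close> with \<open>J / Soc\<^sub>k = Soc (B / Soc\<^sub>k)\<close> is the full preimage of
  \<open>Soc (B / Soc\<^sub>k)\<close>, see the lemma \<open>preimage_unique\<close> below.
\<close>

fun socle_series :: "('a, 'b) semi_brace_scheme \<Rightarrow> nat \<Rightarrow> 'a set" where
  "socle_series B 0 = {\<one>\<^bsub>B\<^esub>}"
| "socle_series B (Suc 0) = socle B"
| "socle_series B (Suc (Suc k)) =
     {a \<in> carrier B. socle_series B (Suc k) #>\<^bsub>B\<^esub> a
                       \<in> socle (quot_semi_brace B (socle_series B (Suc k)))}"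

lemma (in group) preimage_unique:
  assumes "subgroup N G" "subgroup J G" "N \<subseteq> J" "(\<lambda>x. N #> x) ` J = S"
  shows "J = {a \<in> carrier G. N #> a \<in> S}"
proof (intro equalityI subsetI)
  fix a assume "a \<in> J"
  then show "a \<in> {a \<in> carrier G. N #> a \<in> S}"
    using assms subgroup.subset by blast
next
  fix a assume a: "a \<in> {a \<in> carrier G. N #> a \<in> S}"
  then obtain x where x: "x \<in> J" "N #> a = N #> x"
    using assms(4) by auto
  have "a \<in> N #> x"
    using a x(2) rcos_self[OF _ assms(1)] by force
  then show "a \<in> J"
    using x(1) assms(2,3) by (auto simp: r_coset_def intro: subgroup.m_closed)
qed


section \<open>Nilpotency\<close>

definition ann_series :: "('a, 'b) semi_brace_scheme \<Rightarrow> nat \<Rightarrow> 'a set" where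
  "ann_series B k =
     set_splus B (socle_series B k \<inter> upper_central B k) (idem B \<inter> upper_central B k)"

definition nilpotent_semi_brace :: "('a, 'b) semi_brace_scheme \<Rightarrow> bool" where
  "nilpotent_semi_brace B \<longleftrightarrow> (\<exists>n>0. ann_series B n = carrier B)"

text \<open>Both series start at index 1; the value at 0 is an unused convention.\<close>

fun right_series :: "('a, 'b) semi_brace_scheme \<Rightarrow> nat \<Rightarrow> 'a set" where
  "right_series B 0 = carrier B"
| "right_series B (Suc 0) = carrier B"
| "right_series B (Suc (Suc n)) =
     set_splus B (set_dot B (right_series B (Suc n)) (carrier B)) (idem B)"

fun left_series :: "('a, 'b) semi_brace_scheme \<Rightarrow> nat \<Rightarrow> 'a set" where
  "left_series B 0 = carrier B"
| "left_series B (Suc 0) = carrier B"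
| "left_series B (Suc (Suc n)) =
     set_splus B (set_dot B (carrier B) (left_series B (Suc n))) (idem B)"

definition right_nilpotent :: "('a, 'b) semi_brace_scheme \<Rightarrow> bool" where
  "right_nilpotent B \<longleftrightarrow> (\<exists>n>0. right_series B n = idem B)"

definition left_nilpotent :: "('a, 'b) semi_brace_scheme \<Rightarrow> bool" where
  "left_nilpotent B \<longleftrightarrow> (\<exists>n>0. left_series B n = idem B)"

end

theory Submission
  imports Defs "HOL-Algebra.SndIsomorphismGrp"
begin

text \<open>
  Write \<open>S\<^sub>k\<close> for the \<open>k\<close>-th term of the socle series and \<open>\<zeta>\<^sub>j\<close> for the terms of the upper central
  series of \<open>(B, \<circ>)\<close>. Since \<open>a \<cdot> b\<close> equals \<open>\<lambda>\<^sub>a(b)\<close> plus the additive inverse of \<open>b + 0\<close> in \<open>G\<close>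
  (\<open>dot_eq\<close>), and \<open>E\<close> is normal in \<open>(B, \<circ>)\<close>, the element \<open>a \<cdot> b\<close> depends on \<open>a + 0\<close> and \<open>b + 0\<close> only.
  So both series live in \<open>G\<close>, up to adding \<open>E\<close>.

  An element \<open>x\<close> of the socle satisfies \<open>\<lambda>\<^sub>x = id\<close> and is central in \<open>(G, +)\<close>. Consequently
  \<open>x \<cdot> b = 0\<close> (\<open>socle_dot_left\<close>). Moreover the conjugate of \<open>x\<close> by \<open>b\<close> in \<open>(B, \<circ>)\<close> is \<open>\<lambda>\<^sub>b(x) + 0\<close>
  (\<open>socle_conj\<close>), so \<open>b \<cdot> x\<close> is the commutator of \<open>b\<close> and \<open>x\<close> in \<open>(B, \<circ>)\<close> (\<open>socle_dot_right\<close>).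
  The socle is the kernel of a congruence of \<open>B\<close>, hence so is every \<open>S\<^sub>k\<close>, and both facts apply to \<open>B / S\<^sub>k\<close>.

  Suppose that \<open>Ann\<^sub>n(B) = B\<close>. Then \<open>B = S\<^sub>n + E\<close>, and the first fact pushes the right series down
  the socle series, one term at a time, so \<open>B\<close> is right nilpotent.

  For the left series one such step does not suffice, but \<open>n\<close> steps do. Also \<open>B = \<zeta>\<^sub>n \<circ> E\<close>, so
  \<open>(B, \<circ>)\<close> has a central chain of length \<open>n\<close> from \<open>E \<circ> S\<^sub>k\<close> up to \<open>B\<close>. By the second fact, multiplying
  from the left lowers an element of \<open>S\<^sub>k\<^sub>+\<^sub>1 \<inter> G\<close> along this chain modulo \<open>S\<^sub>k\<close>
  (\<open>dot_central_layer\<close>). At the bottom it lies in \<open>(E \<circ> S\<^sub>k) \<inter> G\<close>, which is contained in \<open>S\<^sub>k\<close>. Thus the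
  left series reaches \<open>E\<close> after at most \<open>n\<^sup>2\<close> steps.
\<close>


section \<open>Normal subgroups and the upper central series\<close>

lemma (in group_hom) normal_preimage:
  assumes "N \<lhd> H"
  shows "{x \<in> carrier G. h x \<in> N} \<lhd> G"
proof -
  interpret N: normal N H by fact
  show ?thesis
    by (rule G.normal_invI, rule G.subgroupI) (auto intro: N.inv_op_closed2)
qed

lemma (in group) mult_inv_eq_one_iff:
  assumes "x \<in> carrier G" "y \<in> carrier G"
  shows "x \<otimes> inv y = \<one> \<longleftrightarrow> x = y"
  using assms by (metis inv_closed inv_inv inv_equality r_inv)

lemma (in normal) rcos_eq_iff:
  assumes "x \<in> carrier G" "y \<in> carrier G"
  shows "H #> x = H #> y \<longleftrightarrow> x \<otimes> inv y \<in> H"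
  using assms by (metis is_group rcos_module rcos_self repr_independence subgroup_axioms)

lemma group_centerI:
  "\<lbrakk>x \<in> carrier G; \<And>y. y \<in> carrier G \<Longrightarrow> x \<otimes>\<^bsub>G\<^esub> y = y \<otimes>\<^bsub>G\<^esub> x\<rbrakk> \<Longrightarrow> x \<in> group_center G"
  by (simp add: group_center_def)

lemma group_center_closed: "x \<in> group_center G \<Longrightarrow> x \<in> carrier G"
  by (simp add: group_center_def)

lemma group_center_comm:
  "\<lbrakk>x \<in> group_center G; y \<in> carrier G\<rbrakk> \<Longrightarrow> x \<otimes>\<^bsub>G\<^esub> y = y \<otimes>\<^bsub>G\<^esub> x"
  by (simp add: group_center_def)

lemma (in group) normal_group_center: "group_center G \<lhd> G"
proof (rule normal_invI)
  show "subgroup (group_center G) G"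
  proof (rule subgroupI)
    fix a assume a: "a \<in> group_center G"
    have "inv a \<otimes> y = y \<otimes> inv a" if y: "y \<in> carrier G" for y
    proof -
      have c: "a \<in> carrier G" "a \<otimes> inv y = inv y \<otimes> a"
        using a y by (auto intro: group_center_closed group_center_comm)
      have "inv (a \<otimes> inv y) = inv (inv y \<otimes> a)"
        using c(2) by simp
      then show ?thesis
        using c(1) y by (simp add: inv_mult_group)
    qed
    then show "inv a \<in> group_center G"
      using group_center_closed[OF a] by (simp add: group_centerI)
  next
    fix a b assume a: "a \<in> group_center G" and b: "b \<in> group_center G"
    have "a \<otimes> b \<otimes> y = y \<otimes> (a \<otimes> b)" if y: "y \<in> carrier G" for y
    proof -
      have c: "a \<in> carrier G" "b \<in> carrier G" "a \<otimes> y = y \<otimes> a" "b \<otimes> y = y \<otimes> b"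
        using a b y by (auto intro: group_center_closed group_center_comm)
      have "a \<otimes> b \<otimes> y = a \<otimes> y \<otimes> b"
        using c(1,2,4) y by (simp add: m_assoc)
      also have "\<dots> = y \<otimes> (a \<otimes> b)"
        unfolding c(3) using c(1,2) y by (simp add: m_assoc)
      finally show ?thesis .
    qed
    then show "a \<otimes> b \<in> group_center G"
      using group_center_closed[OF a] group_center_closed[OF b] by (simp add: group_centerI)
  next
    show "group_center G \<subseteq> carrier G"
      by (auto simp: group_center_closed)
    have "\<one> \<in> group_center G"
      by (rule group_centerI) auto
    then show "group_center G \<noteq> {}" by blast
  qed
next
  fix x h assume x: "x \<in> carrier G" and h: "h \<in> group_center G"
  have c: "h \<in> carrier G" "h \<otimes> inv x = inv x \<otimes> h"
    using x h by (auto intro: group_center_closed group_center_comm)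
  have "x \<otimes> h \<otimes> inv x = x \<otimes> (inv x \<otimes> h)"
    using x c by (simp add: m_assoc)
  also have "\<dots> = h"
    using x c by (simp add: m_assoc[symmetric])
  finally show "x \<otimes> h \<otimes> inv x \<in> group_center G"
    using h by simp
qed

lemma (in group) normal_upper_central: "upper_central G k \<lhd> G"
proof (induction k)
  case 0
  show ?case by (simp add: one_is_normal)
next
  case (Suc k)
  then interpret Z: normal "upper_central G k" G .
  interpret Q: group "G Mod upper_central G k" by (rule Z.factorgroup_is_group)
  interpret h: group_hom G "G Mod upper_central G k" "\<lambda>x. upper_central G k #> x"
    by unfold_locales (rule Z.r_coset_hom_Mod)
  show ?case
    using h.normal_preimage[OF Q.normal_group_center] by simp
qed

lemma (in group) upper_central_commutator:
  assumes x: "x \<in> upper_central G (Suc k)" and y: "y \<in> carrier G"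
  shows "y \<otimes> x \<otimes> inv y \<otimes> inv x \<in> upper_central G k"
proof -
  interpret Z: normal "upper_central G k" G by (rule normal_upper_central)
  let ?c = "\<lambda>x. upper_central G k #> x"
  have xc: "x \<in> carrier G" using x by simp
  have "?c y \<in> carrier (G Mod upper_central G k)"
    using y by (auto simp: carrier_FactGroup)
  then have "?c x <#> ?c y = ?c y <#> ?c x"
    using group_center_comm[of "?c x" "G Mod upper_central G k"] x by simp
  then have "?c (y \<otimes> x) = ?c (x \<otimes> y)"
    using xc y by (simp add: Z.rcos_sum)
  then show ?thesis
    using xc y by (simp add: Z.rcos_eq_iff inv_mult_group m_assoc)
qed

text \<open>Multiplying a central chain by a fixed normal subgroup leaves it central.\<close>

lemma (in group) commutator_set_mult_normal:
  assumes Z: "Z \<subseteq> carrier G" and Z': "Z' \<lhd> G" and N: "N \<lhd> G"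
    and comm: "\<And>z. z \<in> Z \<Longrightarrow> b \<otimes> z \<otimes> inv b \<otimes> inv z \<in> Z'"
    and b: "b \<in> carrier G" and w: "w \<in> Z <#> N"
  shows "b \<otimes> w \<otimes> inv b \<otimes> inv w \<in> Z' <#> N"
proof -
  interpret N: normal N G by fact
  obtain z n where z: "z \<in> Z" and n: "n \<in> N" and w: "w = z \<otimes> n"
    using w by (auto simp: set_mult_def)
  have c: "z \<in> carrier G" "n \<in> carrier G"
    using z n Z N.subset by auto
  have cancel: "inv g \<otimes> (g \<otimes> u) = u" if "g \<in> carrier G" "u \<in> carrier G" for g u
    using that by (simp add: m_assoc[symmetric])
  have "b \<otimes> w \<otimes> inv b \<otimes> inv w
      = (b \<otimes> z \<otimes> inv b \<otimes> inv z) \<otimes> (z \<otimes> (b \<otimes> n \<otimes> inv b \<otimes> inv n) \<otimes> inv z)"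
    using b c cancel unfolding w by (simp add: inv_mult_group m_assoc)
  moreover have "z \<otimes> (b \<otimes> n \<otimes> inv b \<otimes> inv n) \<otimes> inv z \<in> N"
    using b c n by (intro N.inv_op_closed2 N.m_closed N.m_inv_closed)
  ultimately show ?thesis
    using comm[OF z] by (auto simp: set_mult_def)
qed


section \<open>Arithmetic in a left semi-brace\<close>

context left_semi_brace
begin

lemma one_splus: "b \<in> carrier B \<Longrightarrow> \<one> \<boxplus> b = b"
proof -
  assume b: "b \<in> carrier B"
  have "\<one> \<otimes> (\<one> \<boxplus> b) = \<one> \<otimes> \<one> \<boxplus> \<one> \<otimes> (inv \<one> \<boxplus> b)"
    using b by (intro semi_brace_distrib) auto
  then have "\<one> \<boxplus> b = \<one> \<boxplus> (\<one> \<boxplus> b)"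
    using b by (simp add: splus_closed)
  then show ?thesis
    using splus_left_cancel[of \<one> b "\<one> \<boxplus> b"] b by (simp add: splus_closed)
qed

lemma lam_closed: "\<lbrakk>a \<in> carrier B; b \<in> carrier B\<rbrakk> \<Longrightarrow> lam B a b \<in> carrier B"
  by (simp add: lam_def splus_closed)

lemma mult_splus:
  "\<lbrakk>a \<in> carrier B; b \<in> carrier B; c \<in> carrier B\<rbrakk> \<Longrightarrow> a \<otimes> (b \<boxplus> c) = a \<otimes> b \<boxplus> lam B a c"
  unfolding lam_def by (rule semi_brace_distrib)

lemma lam_one: "b \<in> carrier B \<Longrightarrow> lam B \<one> b = b"
  by (simp add: lam_def one_splus)

lemma lam_splus:
  assumes "a \<in> carrier B" "b \<in> carrier B" "c \<in> carrier B"
  shows "lam B a (b \<boxplus> c) = lam B a b \<boxplus> lam B a c"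
  using assms mult_splus[of a "inv a \<boxplus> b" c] by (simp add: lam_def splus_assoc splus_closed)

lemma lam_mult:
  assumes "a \<in> carrier B" "b \<in> carrier B" "c \<in> carrier B"
  shows "lam B (a \<otimes> b) c = lam B a (lam B b c)"
proof -
  have "b \<otimes> (inv b \<otimes> inv a \<boxplus> c) = inv a \<boxplus> lam B b c"
    using assms mult_splus[of b "inv b \<otimes> inv a" c] by (simp add: m_assoc[symmetric])
  then show ?thesis
    using assms by (simp add: lam_def inv_mult_group m_assoc splus_closed)
qed

text \<open>
  By the last three lemmas \<open>\<lambda>\<close> is an action of \<open>(B, \<circ>)\<close> on \<open>(B, +)\<close>. Together with the identity
  \<open>a \<circ> b = a + \<lambda>\<^sub>a(b)\<close> it replaces the defining axiom in all computations below.
\<close>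

lemma mult_eq_splus: "\<lbrakk>a \<in> carrier B; b \<in> carrier B\<rbrakk> \<Longrightarrow> a \<otimes> b = a \<boxplus> lam B a b"
  using mult_splus[of a \<one> b] by (simp add: one_splus)

lemma lam_lam_inv:
  "\<lbrakk>a \<in> carrier B; b \<in> carrier B\<rbrakk> \<Longrightarrow> lam B a (lam B (inv a) b) = b"
  by (simp add: lam_mult[symmetric] lam_one)

lemma splus_eq_mult: "\<lbrakk>a \<in> carrier B; b \<in> carrier B\<rbrakk> \<Longrightarrow> a \<boxplus> b = a \<otimes> lam B (inv a) b"
  by (simp add: mult_eq_splus lam_closed lam_lam_inv)

text \<open>
  The element \<open>lam B a (inv a)\<close> is a right additive inverse of every \<open>a\<close>. By the next lemma it lies in \<open>G\<close>, but
  it is a left inverse up to an idempotent only.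
\<close>

lemma splus_lam_inv: "a \<in> carrier B \<Longrightarrow> a \<boxplus> lam B a (inv a) = \<one>"
  by (simp add: mult_eq_splus[symmetric])

lemma lam_inv_splus_one:
  assumes "a \<in> carrier B"
  shows "lam B a (inv a) \<boxplus> \<one> = lam B a (inv a)"
  using assms splus_left_cancel[of a "lam B a (inv a) \<boxplus> \<one>" "lam B a (inv a)"]
  by (simp add: splus_assoc[symmetric] splus_lam_inv lam_closed splus_closed one_splus)

lemma idem_closed: "e \<in> idem B \<Longrightarrow> e \<in> carrier B"
  by (simp add: idem_def)

lemma idem_splus:
  assumes "e \<in> idem B" "b \<in> carrier B"
  shows "e \<boxplus> b = b"
  using assms splus_left_cancel[of e "e \<boxplus> b" b]
  by (simp add: idem_def splus_assoc[symmetric] splus_closed)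

lemma one_idem: "\<one> \<in> idem B"
  by (simp add: idem_def one_splus)

lemma lam_idem: "\<lbrakk>a \<in> carrier B; e \<in> idem B\<rbrakk> \<Longrightarrow> lam B a e \<in> idem B"
  by (auto simp: idem_def lam_closed lam_splus[symmetric])

lemma lam_inv_splus_idem:
  assumes a: "a \<in> carrier B"
  shows "lam B a (inv a) \<boxplus> a \<in> idem B"
proof -
  let ?n = "lam B a (inv a)"
  have n: "?n \<in> carrier B" using a by (simp add: lam_closed)
  have "?n \<boxplus> a \<boxplus> (?n \<boxplus> a) = ?n \<boxplus> (a \<boxplus> ?n) \<boxplus> a"
    using a n by (simp add: splus_assoc splus_closed)
  also have "\<dots> = ?n \<boxplus> a"
    using a by (simp add: splus_lam_inv lam_inv_splus_one)
  finally show ?thesis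
    using a n by (simp add: idem_def splus_closed)
qed

text \<open>
  Here \<open>lam B b (inv b)\<close> is the additive inverse of \<open>b \<boxplus> \<one>\<close> in \<open>G\<close>, so this is the usual
  operation \<open>\<lambda>\<^sub>a(b) - b\<close> of skew left braces.
\<close>

lemma dot_eq:
  assumes a: "a \<in> carrier B" and b: "b \<in> carrier B"
  shows "dot B a b = lam B a b \<boxplus> lam B b (inv b)"
proof -
  have "lam B a (inv a) \<boxplus> a \<otimes> b = (lam B a (inv a) \<boxplus> a) \<boxplus> lam B a b"
    using a b by (simp add: mult_eq_splus splus_assoc lam_closed)
  also have "\<dots> = lam B a b"
    using a b by (simp add: idem_splus lam_inv_splus_idem lam_closed)
  finally show ?thesis by (simp add: dot_def)
qed

lemma dot_closed: "\<lbrakk>a \<in> carrier B; b \<in> carrier B\<rbrakk> \<Longrightarrow> dot B a b \<in> carrier B"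
  by (simp add: dot_eq lam_closed splus_closed)

lemma carrier_add_group_iff:
  "g \<in> carrier (add_group B) \<longleftrightarrow> g \<in> carrier B \<and> g \<boxplus> \<one> = g"
  by (auto simp: add_group_def splus_closed splus_assoc one_splus intro: exI[of _ g])

lemma splus_one_add_group: "a \<in> carrier B \<Longrightarrow> a \<boxplus> \<one> \<in> carrier (add_group B)"
  by (auto simp: add_group_def)

lemma dot_add_group:
  "\<lbrakk>a \<in> carrier B; b \<in> carrier B\<rbrakk> \<Longrightarrow> dot B a b \<in> carrier (add_group B)"
  by (simp add: carrier_add_group_iff dot_eq lam_closed splus_closed splus_assoc
      lam_inv_splus_one)

lemma lam_inv_splus_self:
  assumes "g \<in> carrier (add_group B)"
  shows "lam B g (inv g) \<boxplus> g = \<one>"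
proof -
  have g: "g \<in> carrier B" "g \<boxplus> \<one> = g" using assms by (auto simp: carrier_add_group_iff)
  have "lam B g (inv g) \<boxplus> g = lam B g (inv g) \<boxplus> g \<boxplus> \<one>"
    using g by (simp add: splus_assoc lam_closed)
  also have "\<dots> = \<one>"
    using g by (intro idem_splus lam_inv_splus_idem) auto
  finally show ?thesis .
qed

lemma group_add_group: "group (add_group B)"
proof (rule groupI)
  show "\<exists>y\<in>carrier (add_group B). y \<otimes>\<^bsub>add_group B\<^esub> x = \<one>\<^bsub>add_group B\<^esub>"
    if x: "x \<in> carrier (add_group B)" for x
  proof
    show "lam B x (inv x) \<in> carrier (add_group B)"
      using x by (simp add: carrier_add_group_iff lam_closed lam_inv_splus_one)
    show "lam B x (inv x) \<otimes>\<^bsub>add_group B\<^esub> x = \<one>\<^bsub>add_group B\<^esub>"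
      using lam_inv_splus_self[OF x] by (simp add: add_group_def)
  qed
next
  fix x y z assume "x \<in> carrier (add_group B)" "y \<in> carrier (add_group B)"
  then show "x \<otimes>\<^bsub>add_group B\<^esub> y \<in> carrier (add_group B)"
    unfolding carrier_add_group_iff by (simp add: add_group_def splus_closed splus_assoc)
  assume "z \<in> carrier (add_group B)"
  with \<open>x \<in> _\<close> \<open>y \<in> _\<close>
  show "x \<otimes>\<^bsub>add_group B\<^esub> y \<otimes>\<^bsub>add_group B\<^esub> z = x \<otimes>\<^bsub>add_group B\<^esub> (y \<otimes>\<^bsub>add_group B\<^esub> z)"
    unfolding carrier_add_group_iff by (simp add: add_group_def splus_assoc)
next
  show "\<one>\<^bsub>add_group B\<^esub> \<in> carrier (add_group B)"
    unfolding carrier_add_group_iff by (simp add: add_group_def one_splus)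
next
  fix x assume "x \<in> carrier (add_group B)"
  then show "\<one>\<^bsub>add_group B\<^esub> \<otimes>\<^bsub>add_group B\<^esub> x = x"
    unfolding carrier_add_group_iff by (simp add: add_group_def one_splus)
qed

lemma inv_add_group:
  assumes "g \<in> carrier (add_group B)"
  shows "inv\<^bsub>add_group B\<^esub> g = lam B g (inv g)"
proof (rule group.inv_equality[OF group_add_group _ assms])
  show "lam B g (inv g) \<otimes>\<^bsub>add_group B\<^esub> g = \<one>\<^bsub>add_group B\<^esub>"
    using lam_inv_splus_self[OF assms] by (simp add: add_group_def)
  show "lam B g (inv g) \<in> carrier (add_group B)"
    using assms by (simp add: carrier_add_group_iff lam_closed lam_inv_splus_one)
qed


section \<open>The socle\<close>

text \<open>
  The condition \<open>\<rho>\<^sub>a = \<rho>\<^sub>0\<close> on an element with \<open>\<lambda>\<^sub>a = id\<close> unfolds to \<open>b + a = a + b + 0\<close>. Taking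
  \<open>b = 0\<close> gives \<open>a \<in> G\<close>, and then the condition says that \<open>a\<close> is central in \<open>(G, +)\<close>.
\<close>

lemma socle_iff:
  "a \<in> socle B \<longleftrightarrow> a \<in> carrier B \<and>
     (\<forall>b \<in> carrier B. lam B a b = b) \<and> (\<forall>b \<in> carrier B. b \<boxplus> a = a \<boxplus> b \<boxplus> \<one>)"
proof -
  have rho: "rho B a (inv b) = rho B \<one> (inv b) \<longleftrightarrow> b \<boxplus> a = a \<boxplus> b \<boxplus> \<one>"
    if a: "a \<in> carrier B" and lam: "\<forall>b \<in> carrier B. lam B a b = b" and b: "b \<in> carrier B" for a b
  proof -
    have c: "b \<boxplus> a \<in> carrier B" "b \<boxplus> \<one> \<in> carrier B" using a b by (auto simp: splus_closed)
    have "rho B a (inv b) = rho B \<one> (inv b) \<longleftrightarrow> inv (b \<boxplus> a) \<otimes> a = inv (b \<boxplus> \<one>)"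
      using b c by (simp add: rho_def)
    also have "\<dots> \<longleftrightarrow> b \<boxplus> a = a \<otimes> (b \<boxplus> \<one>)"
      using a c by (metis inv_closed inv_solve_left inv_solve_right m_closed inv_inv)
    also have "a \<otimes> (b \<boxplus> \<one>) = a \<boxplus> b \<boxplus> \<one>"
      using a b c lam by (simp add: mult_eq_splus splus_assoc)
    finally show ?thesis .
  qed
  have *: "(\<forall>b \<in> carrier B. P (inv b)) \<longleftrightarrow> (\<forall>b \<in> carrier B. P b)" for P
    by (metis inv_closed inv_inv)
  have "a \<in> socle B \<longleftrightarrow> a \<in> carrier B \<and> (\<forall>b \<in> carrier B. lam B a b = b) \<and>
     (\<forall>b \<in> carrier B. rho B a b = rho B \<one> b)"
    by (auto simp: socle_def lam_one)
  then show ?thesis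
    using rho by (auto simp: *[of "\<lambda>b. rho B a b = rho B \<one> b", symmetric])
qed

lemma socle_closed: "a \<in> socle B \<Longrightarrow> a \<in> carrier B"
  by (simp add: socle_iff)

lemma socle_lam: "\<lbrakk>a \<in> socle B; b \<in> carrier B\<rbrakk> \<Longrightarrow> lam B a b = b"
  by (simp add: socle_iff)

lemma socle_mult: "\<lbrakk>a \<in> socle B; b \<in> carrier B\<rbrakk> \<Longrightarrow> a \<otimes> b = a \<boxplus> b"
  by (simp add: socle_iff mult_eq_splus)

lemma socle_central: "\<lbrakk>a \<in> socle B; b \<in> carrier B\<rbrakk> \<Longrightarrow> b \<boxplus> a = a \<boxplus> b \<boxplus> \<one>"
  by (simp add: socle_iff)

lemma lam_id_inv:
  assumes "a \<in> carrier B" "\<And>b. b \<in> carrier B \<Longrightarrow> lam B a b = b" "b \<in> carrier B"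
  shows "lam B (inv a) b = b"
  using assms by (metis inv_closed l_inv lam_mult lam_one)

lemma lam_conj_id:
  assumes a: "a \<in> carrier B" "\<And>b. b \<in> carrier B \<Longrightarrow> lam B a b = b"
    and b: "b \<in> carrier B" and c: "c \<in> carrier B"
  shows "lam B (b \<otimes> a \<otimes> inv b) c = c"
  using assms by (simp add: lam_mult lam_closed lam_lam_inv)

lemma lam_id_splus_one:
  assumes a: "a \<in> carrier B" "\<And>b. b \<in> carrier B \<Longrightarrow> lam B a b = b"
  shows "a \<boxplus> \<one> = a"
  using a mult_eq_splus[of a \<one>] by simp

text \<open>
  Conjugating by \<open>b\<close> in \<open>(B, \<circ>)\<close> is applying \<open>\<lambda>\<^sub>b\<close>, up to the projection \<open>B \<rightarrow> G\<close>.
\<close>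

lemma socle_conj:
  assumes a: "a \<in> socle B" and b: "b \<in> carrier B"
  shows "b \<otimes> a \<otimes> inv b = lam B b a \<boxplus> \<one>"
proof -
  note c = socle_closed[OF a]
  have "b \<otimes> a \<otimes> inv b \<boxplus> lam B b \<one> = b \<otimes> (a \<boxplus> inv b \<boxplus> \<one>)"
    using a b c by (simp add: mult_splus splus_closed m_assoc socle_mult)
  also have "\<dots> = b \<otimes> (inv b \<boxplus> a)"
    using a b by (simp add: socle_central)
  also have "\<dots> = lam B b a"
    by (simp add: lam_def)
  finally have "b \<otimes> a \<otimes> inv b \<boxplus> lam B b \<one> \<boxplus> \<one> = lam B b a \<boxplus> \<one>"
    by simp
  then have "b \<otimes> a \<otimes> inv b \<boxplus> \<one> = lam B b a \<boxplus> \<one>"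
    using b c by (simp add: splus_assoc lam_closed idem_splus lam_idem one_idem)
  \<comment> \<open>The conjugate lies in \<open>G\<close> because \<open>\<lambda>\<close> is trivial on it.\<close>
  moreover have "b \<otimes> a \<otimes> inv b \<boxplus> \<one> = b \<otimes> a \<otimes> inv b"
    using lam_id_splus_one[of "b \<otimes> a \<otimes> inv b"] lam_conj_id[of a b] socle_lam[OF a] b c by simp
  ultimately show ?thesis by simp
qed

lemma normal_socle: "socle B \<lhd> B"
proof (rule normal_invI)
  show "subgroup (socle B) B"
  proof (rule subgroupI)
    show "socle B \<subseteq> carrier B" by (auto simp: socle_closed)
    have "\<one> \<in> socle B"
      by (auto simp: socle_iff lam_one one_splus)
    then show "socle B \<noteq> {}" by blast
  next
    fix a assume a: "a \<in> socle B"
    note c = socle_closed[OF a]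
    have lam: "lam B (inv a) b = b" if "b \<in> carrier B" for b
      using that lam_id_inv[OF c] socle_lam[OF a] by simp
    have "b \<boxplus> inv a = inv a \<boxplus> b \<boxplus> \<one>" if b: "b \<in> carrier B" for b
    proof (rule splus_left_cancel[of a])
      have ia: "a \<boxplus> inv a = \<one>" 
        using socle_mult[OF a, of "inv a"] c by simp
      have "a \<boxplus> (b \<boxplus> inv a) = a \<boxplus> b \<boxplus> \<one> \<boxplus> inv a"
        using b c by (simp add: splus_assoc splus_closed one_splus)
      also have "\<dots> = b \<boxplus> (a \<boxplus> inv a)"
        using socle_central[OF a b, symmetric] b c by (simp add: splus_assoc)
      also have "\<dots> = a \<boxplus> inv a \<boxplus> b \<boxplus> \<one>"
        using b c by (simp add: ia one_splus)
      also have "\<dots> = a \<boxplus> (inv a \<boxplus> b \<boxplus> \<one>)"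
        using b c by (simp add: splus_assoc splus_closed)
      finally show "a \<boxplus> (b \<boxplus> inv a) = a \<boxplus> (inv a \<boxplus> b \<boxplus> \<one>)" .
    qed (use b c in \<open>auto simp: splus_closed\<close>)
    then show "inv a \<in> socle B"
      using c lam by (simp add: socle_iff)
  next
    fix a b assume a: "a \<in> socle B" and b: "b \<in> socle B"
    note c = socle_closed[OF a] socle_closed[OF b]
    have "d \<boxplus> (a \<otimes> b) = a \<otimes> b \<boxplus> d \<boxplus> \<one>" if d: "d \<in> carrier B" for d
    proof -
      have "d \<boxplus> (a \<otimes> b) = (a \<boxplus> d \<boxplus> \<one>) \<boxplus> b"
        using a c d socle_central[OF a d] by (simp add: socle_mult splus_assoc[symmetric])
      also have "\<dots> = a \<boxplus> (d \<boxplus> b)"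
        using c d by (simp add: splus_assoc splus_closed one_splus)
      also have "\<dots> = a \<otimes> b \<boxplus> d \<boxplus> \<one>"
        using a c d socle_central[OF b d] by (simp add: socle_mult splus_assoc splus_closed)
      finally show ?thesis .
    qed
    then show "a \<otimes> b \<in> socle B"
      using c a b by (simp add: socle_iff[of "a \<otimes> b"] lam_mult socle_lam)
  qed
next
  fix x a assume x: "x \<in> carrier B" and a: "a \<in> socle B"
  note c = socle_closed[OF a]
  let ?y = "x \<otimes> a \<otimes> inv x"
  have lam: "lam B ?y b = b" if "b \<in> carrier B" for b
    using that lam_conj_id[OF c _ x] socle_lam[OF a] by simp
  have "d \<boxplus> ?y = ?y \<boxplus> d \<boxplus> \<one>" if d: "d \<in> carrier B" for d
  proof -
    define d' where "d' = lam B (inv x) d"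
    have d': "d' \<in> carrier B" "d = lam B x d'"
      using d x by (auto simp: d'_def lam_closed lam_lam_inv)
    have "d \<boxplus> ?y = lam B x (d' \<boxplus> a) \<boxplus> \<one>"
      using x c d' by (simp add: socle_conj[OF a x] lam_splus splus_assoc lam_closed)
    also have "\<dots> = lam B x (a \<boxplus> d') \<boxplus> (lam B x \<one> \<boxplus> \<one>)"
      using x c d' by (simp add: socle_central[OF a d'(1)] lam_splus splus_assoc lam_closed
          splus_closed)
    also have "\<dots> = lam B x a \<boxplus> d \<boxplus> \<one>"
      using x c d' by (simp add: lam_splus idem_splus lam_idem one_idem)
    also have "\<dots> = ?y \<boxplus> d \<boxplus> \<one>"
      using x c d by (simp add: socle_conj[OF a x] splus_assoc lam_closed splus_closed one_splus)
    finally show ?thesis .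
  qed
  then show "?y \<in> socle B"
    using lam x c by (simp add: socle_iff)
qed

lemma socle_dot_left: "\<lbrakk>x \<in> socle B; b \<in> carrier B\<rbrakk> \<Longrightarrow> dot B x b = \<one>"
  by (simp add: dot_eq socle_closed socle_lam splus_lam_inv)

text \<open>On the socle the additive action of \<open>B\<close> is conjugation, hence this commutator.\<close>

lemma socle_dot_right:
  assumes x: "x \<in> socle B" and b: "b \<in> carrier B"
  shows "dot B b x = b \<otimes> x \<otimes> inv b \<otimes> inv x"
proof -
  note c = socle_closed[OF x]
  interpret S: normal "socle B" B by (rule normal_socle)
  have "b \<otimes> x \<otimes> inv b \<otimes> inv x = (lam B b x \<boxplus> \<one>) \<boxplus> inv x"
    using S.inv_op_closed2[OF b x] c by (simp add: socle_mult socle_conj[OF x b, symmetric])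
  also have "\<dots> = lam B b x \<boxplus> lam B x (inv x)"
    using b c x by (simp add: splus_assoc lam_closed one_splus socle_lam)
  finally show ?thesis
    using b c by (simp add: dot_eq)
qed

end


section \<open>Congruence kernels and quotients\<close>

text \<open>
  A normal subgroup of \<open>(B, \<circ>)\<close> whose cosets are compatible with the addition. Such an \<open>I\<close> is the
  class of \<open>0\<close> of a congruence, and this compatibility is all that the quotient requires.
\<close>

locale congruence_kernel = left_semi_brace B + normal I B for I and B (structure) +
  assumes coset_splus_cong:
    "\<lbrakk>a \<in> carrier B; a' \<in> carrier B; b \<in> carrier B; b' \<in> carrier B;
      I #> a = I #> a'; I #> b = I #> b'\<rbrakk> \<Longrightarrow> I #> (a \<boxplus> b) = I #> (a' \<boxplus> b')"
begin

lemma coset_one: "I #> \<one> = I"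
  using subset by simp

lemma coset_eq_kernel_iff: "a \<in> carrier B \<Longrightarrow> I #> a = I \<longleftrightarrow> a \<in> I"
  using rcos_eq_iff[of a \<one>] coset_one by simp

lemma coset_mem: "x \<in> I \<Longrightarrow> I #> x = I"
  by (rule rcos_const[OF is_group])

lemma coset_lam_cong:
  assumes "a \<in> carrier B" "b \<in> carrier B" "b' \<in> carrier B" "I #> b = I #> b'"
  shows "I #> lam B a b = I #> lam B a b'"
proof -
  have "I #> (inv a \<boxplus> b) = I #> (inv a \<boxplus> b')"
    using assms by (intro coset_splus_cong) auto
  then have "(I #> a) <#> (I #> (inv a \<boxplus> b)) = (I #> a) <#> (I #> (inv a \<boxplus> b'))"
    by simp
  then show ?thesis
    using assms by (simp add: rcos_sum splus_closed lam_def)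
qed

lemma lam_inv_mem:
  assumes x: "x \<in> I"
  shows "lam B x (inv x) \<in> I"
proof -
  let ?n = "lam B x (inv x)"
  have c: "x \<in> carrier B" "?n \<in> carrier B" using x subset by (auto intro: lam_closed)
  have "I #> ?n = I #> (\<one> \<boxplus> ?n)"
    using c by (simp add: one_splus)
  also have "\<dots> = I #> (x \<boxplus> ?n)"
    using c x by (intro coset_splus_cong) (auto simp: coset_one coset_mem)
  also have "\<dots> = I"
    using c by (simp add: splus_lam_inv coset_one)
  finally show ?thesis
    using c by (simp add: coset_eq_kernel_iff)
qed

lemma splus_mem:
  assumes "x \<in> I" "y \<in> I"
  shows "x \<boxplus> y \<in> I"
proof -
  have c: "x \<in> carrier B" "y \<in> carrier B" using assms subset by auto
  have "I #> (x \<boxplus> y) = I #> (\<one> \<boxplus> \<one>)"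
    using c assms by (intro coset_splus_cong) (auto simp: coset_one coset_mem)
  then show ?thesis
    using c by (simp add: one_splus coset_one coset_eq_kernel_iff splus_closed)
qed

lemma dot_mem_right:
  assumes b: "b \<in> carrier B" and x: "x \<in> I"
  shows "dot B b x \<in> I"
proof -
  let ?n = "lam B x (inv x)"
  have c: "x \<in> carrier B" "?n \<in> carrier B" using x subset by (auto intro: lam_closed)
  have "I #> lam B b x = I #> lam B b \<one>"
    using b c x by (intro coset_lam_cong) (auto simp: coset_one coset_mem)
  then have "I #> (lam B b x \<boxplus> ?n) = I #> (lam B b \<one> \<boxplus> ?n)"
    using b c by (intro coset_splus_cong) (auto simp: lam_closed)
  also have "\<dots> = I"
    using b c lam_inv_mem[OF x] by (simp add: idem_splus lam_idem one_idem coset_eq_kernel_iff)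
  finally show ?thesis
    using b c by (simp add: dot_eq coset_eq_kernel_iff lam_closed splus_closed)
qed

lemma subgroup_kernel_add_group: "subgroup (I \<inter> carrier (add_group B)) (add_group B)"
proof -
  interpret A: group "add_group B" by (rule group_add_group)
  show ?thesis
  proof (rule A.subgroupI)
    have "\<one>\<^bsub>add_group B\<^esub> \<in> I \<inter> carrier (add_group B)"
      by (auto simp: add_group_def intro: exI[of _ \<one>] simp: one_splus)
    then show "I \<inter> carrier (add_group B) \<noteq> {}" by blast
  next
    fix a assume a: "a \<in> I \<inter> carrier (add_group B)"
    then show "inv\<^bsub>add_group B\<^esub> a \<in> I \<inter> carrier (add_group B)"
      using A.inv_closed[of a] lam_inv_mem by (auto simp: inv_add_group)
  next
    fix a b assume ab: "a \<in> I \<inter> carrier (add_group B)" "b \<in> I \<inter> carrier (add_group B)"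
    then show "a \<otimes>\<^bsub>add_group B\<^esub> b \<in> I \<inter> carrier (add_group B)"
      using A.m_closed[of a b] splus_mem[of a b] by (simp add: add_group_def)
  qed auto
qed

abbreviation Q where "Q \<equiv> quot_semi_brace B I"

lemma quot_carrier: "carrier Q = (\<lambda>a. I #> a) ` carrier B"
  by (simp add: quot_semi_brace_def carrier_FactGroup)

lemma quot_closed: "a \<in> carrier B \<Longrightarrow> I #> a \<in> carrier Q"
  by (simp add: quot_carrier)

lemma quot_one: "\<one>\<^bsub>Q\<^esub> = I"
  by (simp add: quot_semi_brace_def)

lemma quot_mult:
  "\<lbrakk>a \<in> carrier B; b \<in> carrier B\<rbrakk> \<Longrightarrow> (I #> a) \<otimes>\<^bsub>Q\<^esub> (I #> b) = I #> (a \<otimes> b)"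
  by (simp add: quot_semi_brace_def rcos_sum)

lemma quot_splus:
  assumes a: "a \<in> carrier B" and b: "b \<in> carrier B"
  shows "(I #> a) \<boxplus>\<^bsub>Q\<^esub> (I #> b) = I #> (a \<boxplus> b)"
proof -
  have "I #> (x \<boxplus> y) = I #> (a \<boxplus> b)" if x: "x \<in> I #> a" and y: "y \<in> I #> b" for x y
  proof (rule coset_splus_cong)
    show "x \<in> carrier B" "y \<in> carrier B"
      using elemrcos_carrier[OF is_group] x y a b by auto
    show "I #> x = I #> a" "I #> y = I #> b"
      using repr_independence[OF _ _ is_subgroup] x y a b by auto
  qed fact+
  moreover have "I #> a \<noteq> {}" "I #> b \<noteq> {}"
    using a b rcos_self[OF _ is_subgroup] by auto
  ultimately show ?thesis
    by (auto simp: quot_semi_brace_def)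
qed

lemma group_quot: "group Q"
  using factorgroup_is_group
  by (simp add: quot_semi_brace_def group_def monoid_def group_axioms_def Units_def)

lemma quot_inv: "a \<in> carrier B \<Longrightarrow> inv\<^bsub>Q\<^esub> (I #> a) = I #> inv a"
  by (rule group.inv_equality[OF group_quot])
     (auto simp: quot_mult quot_one coset_one quot_closed)

lemmas quot_simps = quot_closed quot_mult quot_splus quot_inv lam_closed splus_closed

lemma quot_lam:
  "\<lbrakk>a \<in> carrier B; b \<in> carrier B\<rbrakk> \<Longrightarrow> lam Q (I #> a) (I #> b) = I #> lam B a b"
  by (simp add: lam_def quot_simps)

lemma quot_dot:
  "\<lbrakk>a \<in> carrier B; b \<in> carrier B\<rbrakk> \<Longrightarrow> dot Q (I #> a) (I #> b) = I #> dot B a b"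
  by (simp add: dot_def quot_simps quot_lam)

lemma left_semi_brace_quot: "left_semi_brace Q"
proof (intro left_semi_brace.intro[OF group_quot] left_semi_brace_axioms.intro)
  fix X Y Z assume "X \<in> carrier Q" "Y \<in> carrier Q" "Z \<in> carrier Q"
  then obtain a b c where X: "X = I #> a" "a \<in> carrier B" and Y: "Y = I #> b" "b \<in> carrier B"
    and Z: "Z = I #> c" "c \<in> carrier B"
    by (auto simp: quot_carrier)
  show "X \<boxplus>\<^bsub>Q\<^esub> Y \<boxplus>\<^bsub>Q\<^esub> Z = X \<boxplus>\<^bsub>Q\<^esub> (Y \<boxplus>\<^bsub>Q\<^esub> Z)"
    using X Y Z by (simp add: quot_simps splus_assoc)
  show "X \<otimes>\<^bsub>Q\<^esub> (Y \<boxplus>\<^bsub>Q\<^esub> Z) = X \<otimes>\<^bsub>Q\<^esub> Y \<boxplus>\<^bsub>Q\<^esub> X \<otimes>\<^bsub>Q\<^esub> (inv\<^bsub>Q\<^esub> X \<boxplus>\<^bsub>Q\<^esub> Z)"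
    using X Y Z semi_brace_distrib[of a b c] by (simp add: quot_simps)
  assume "X \<boxplus>\<^bsub>Q\<^esub> Y = X \<boxplus>\<^bsub>Q\<^esub> Z"
  then have "I #> (a \<boxplus> b) = I #> (a \<boxplus> c)"
    using X Y Z by (simp add: quot_simps)
  \<comment> \<open>Adding the one-sided additive inverse of \<open>a\<close> on the left cancels \<open>a\<close>.\<close>
  then have "I #> (lam B a (inv a) \<boxplus> (a \<boxplus> b)) = I #> (lam B a (inv a) \<boxplus> (a \<boxplus> c))"
    by (rule coset_splus_cong[OF _ _ _ _ refl, rotated -1]) (use X Y Z in \<open>simp_all add: quot_simps\<close>)
  then show "Y = Z"
    using X Y Z by (simp add: splus_assoc[symmetric] quot_simps idem_splus lam_inv_splus_idem)
next
  fix X Y assume "X \<in> carrier Q" "Y \<in> carrier Q"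
  then show "X \<boxplus>\<^bsub>Q\<^esub> Y \<in> carrier Q"
    by (auto simp: quot_carrier quot_splus splus_closed)
qed

text \<open>
  Correspondence: congruence kernels of the quotient pull back to congruence kernels of \<open>B\<close>.
\<close>

lemma congruence_kernel_preimage:
  assumes "congruence_kernel N Q"
  shows "congruence_kernel {a \<in> carrier B. I #> a \<in> N} B"
proof -
  interpret N: congruence_kernel N Q by fact
  let ?J = "{a \<in> carrier B. I #> a \<in> N}"
  have "group_hom B Q (\<lambda>a. I #> a)"
    by (intro group_hom.intro group_hom_axioms.intro is_group group_quot homI quot_closed)
       (assumption, rule quot_mult[symmetric])
  then have "?J \<lhd> B" by (rule group_hom.normal_preimage) (rule N.normal_axioms)
  then interpret J: normal ?J B .
  have eq: "?J #> a = ?J #> b \<longleftrightarrow> N #>\<^bsub>Q\<^esub> (I #> a) = N #>\<^bsub>Q\<^esub> (I #> b)"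
    if a: "a \<in> carrier B" and b: "b \<in> carrier B" for a b
  proof -
    have "?J #> a = ?J #> b \<longleftrightarrow> I #> (a \<otimes> inv b) \<in> N"
      unfolding J.rcos_eq_iff[OF a b] mem_Collect_eq using monoid.m_closed[OF is_monoid a inv_closed[OF b]] by blast
    also have "I #> (a \<otimes> inv b) = (I #> a) \<otimes>\<^bsub>Q\<^esub> inv\<^bsub>Q\<^esub> (I #> b)"
      using a b by (simp only: quot_inv quot_mult inv_closed)
    finally show ?thesis
      unfolding N.rcos_eq_iff[OF quot_closed[OF a] quot_closed[OF b]] .
  qed
  show ?thesis
  proof (intro congruence_kernel.intro congruence_kernel_axioms.intro
      left_semi_brace_axioms J.normal_axioms)
    fix a a' b b'
    assume "a \<in> carrier B" "a' \<in> carrier B" "b \<in> carrier B" "b' \<in> carrier B"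
      "?J #> a = ?J #> a'" "?J #> b = ?J #> b'"
    then show "?J #> (a \<boxplus> b) = ?J #> (a' \<boxplus> b')"
      using N.coset_splus_cong[of "I #> a" "I #> a'" "I #> b" "I #> b'"]
      by (simp only: eq quot_closed quot_splus splus_closed)
  qed
qed

end

lemma (in left_semi_brace) congruence_kernel_socle: "congruence_kernel (socle B) B"
proof -
  interpret S: normal "socle B" B by (rule normal_socle)
  show ?thesis
  proof unfold_locales
    fix a a' b b'
    assume c: "a \<in> carrier B" "a' \<in> carrier B" "b \<in> carrier B" "b' \<in> carrier B"
      and "socle B #> a = socle B #> a'" "socle B #> b = socle B #> b'"
    then have s: "a \<otimes> inv a' \<in> socle B" "b \<otimes> inv b' \<in> socle B"
      by (auto simp: S.rcos_eq_iff)
    define s t where "s = a \<otimes> inv a'" and "t = b \<otimes> inv b'"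
    have st: "s \<in> socle B" "t \<in> socle B" "s \<in> carrier B" "t \<in> carrier B"
      using s by (auto simp: s_def t_def socle_closed)
    have "a = s \<otimes> a'" "b = t \<otimes> b'"
      using c by (auto simp: s_def t_def m_assoc)
    then have ab: "a = s \<boxplus> a'" "b = t \<boxplus> b'"
      using c st by (auto simp: socle_mult)
    have "a \<boxplus> b = s \<boxplus> (a' \<boxplus> t) \<boxplus> b'"
      using c st by (simp add: ab splus_assoc splus_closed)
    also have "\<dots> = s \<boxplus> (t \<boxplus> a' \<boxplus> \<one>) \<boxplus> b'"
      using c st by (simp add: socle_central)
    also have "\<dots> = s \<boxplus> (t \<boxplus> (a' \<boxplus> b'))"
      using c st by (simp add: splus_assoc splus_closed one_splus)
    also have "\<dots> = s \<otimes> (t \<otimes> (a' \<boxplus> b'))"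
      using c st by (simp add: socle_mult splus_closed)
    finally have "(a \<boxplus> b) \<otimes> inv (a' \<boxplus> b') = s \<otimes> t"
      using c st by (simp add: m_assoc splus_closed)
    then show "socle B #> (a \<boxplus> b) = socle B #> (a' \<boxplus> b')"
      using c st by (simp add: S.rcos_eq_iff splus_closed)
  qed
qed

text \<open>The full preimage of \<open>Soc (B / I)\<close>, that is, the next term of a socle series above \<open>I\<close>.\<close>

definition socle_above :: "('a, 'b) semi_brace_scheme \<Rightarrow> 'a set \<Rightarrow> 'a set" where
  "socle_above B I = {a \<in> carrier B. I #>\<^bsub>B\<^esub> a \<in> socle (quot_semi_brace B I)}"

context congruence_kernel
begin

lemma congruence_kernel_socle_above: "congruence_kernel (socle_above B I) B"
  unfolding socle_above_def
  by (intro congruence_kernel_preimage left_semi_brace.congruence_kernel_socle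
      left_semi_brace_quot)

lemma socle_aboveD:
  assumes "x \<in> socle_above B I"
  shows "x \<in> carrier B" "I #> x \<in> socle Q"
  using assms by (auto simp: socle_above_def)

lemma dot_socle_above_left:
  assumes x: "x \<in> socle_above B I" and b: "b \<in> carrier B"
  shows "dot B x b \<in> I"
proof -
  interpret Q: left_semi_brace Q by (rule left_semi_brace_quot)
  have "dot Q (I #> x) (I #> b) = \<one>\<^bsub>Q\<^esub>"
    using socle_aboveD[OF x] b by (intro Q.socle_dot_left) (auto simp: quot_closed)
  then show ?thesis
    using socle_aboveD[OF x] b by (simp add: quot_dot quot_one dot_closed coset_eq_kernel_iff)
qed

lemma dot_socle_above_right:
  assumes x: "x \<in> socle_above B I" and b: "b \<in> carrier B"
  shows "I #> dot B b x = I #> (b \<otimes> x \<otimes> inv b \<otimes> inv x)"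
proof -
  interpret Q: left_semi_brace Q by (rule left_semi_brace_quot)
  show ?thesis
    using Q.socle_dot_right[of "I #> x" "I #> b"] socle_aboveD[OF x] b
    by (simp add: quot_dot quot_simps)
qed

lemma mult_socle_above:
  assumes x: "x \<in> socle_above B I" and b: "b \<in> carrier B"
  shows "I #> (x \<boxplus> b) = I #> (x \<otimes> b)"
proof -
  interpret Q: left_semi_brace Q by (rule left_semi_brace_quot)
  show ?thesis
    using Q.socle_mult[of "I #> x" "I #> b"] socle_aboveD[OF x] b
    by (simp add: quot_simps)
qed

lemma lam_inv_socle_above:
  assumes x: "x \<in> socle_above B I"
  shows "I #> lam B x (inv x) = I #> inv x"
proof -
  interpret Q: left_semi_brace Q by (rule left_semi_brace_quot)
  show ?thesis
    using Q.socle_lam[of "I #> x" "I #> inv x"] socle_aboveD[OF x]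
    by (simp add: quot_simps quot_lam)
qed

end

lemma (in left_semi_brace) congruence_kernel_one: "congruence_kernel {\<one>} B"
proof -
  interpret N: normal "{\<one>}" B by (rule one_is_normal)
  show ?thesis
    by unfold_locales (simp add: N.rcos_eq_iff mult_inv_eq_one_iff)
qed

text \<open>
  The first socle term is defined separately, but it is also the term above the trivial kernel.
\<close>

lemma (in left_semi_brace) socle_series_Suc:
  "socle_series B (Suc k) = socle_above B (socle_series B k)"
proof (cases k)
  case 0
  interpret I: congruence_kernel "{\<one>}" B by (rule congruence_kernel_one)
  interpret Q: left_semi_brace "quot_semi_brace B {\<one>}" by (rule I.left_semi_brace_quot)
  have eq: "{\<one>} #> a = {\<one>} #> b \<longleftrightarrow> a = b" if "a \<in> carrier B" "b \<in> carrier B" for a b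
    using that by (simp add: I.rcos_eq_iff mult_inv_eq_one_iff)
  have one: "({\<one>} #> a) \<boxplus>\<^bsub>quot_semi_brace B {\<one>}\<^esub> {\<one>} = {\<one>} #> (a \<boxplus> \<one>)"
    if "a \<in> carrier B" for a
    using that I.quot_splus[of a \<one>] by (simp add: I.coset_one)
  have "{\<one>} #> a \<in> socle (quot_semi_brace B {\<one>}) \<longleftrightarrow> a \<in> socle B" if "a \<in> carrier B" for a
    unfolding Q.socle_iff socle_iff I.quot_one I.quot_carrier
    using that by (simp add: one I.quot_simps I.quot_lam eq)
  then show ?thesis
    using 0 by (auto simp: socle_above_def socle_closed)
qed (simp add: socle_above_def)

lemma (in left_semi_brace) congruence_kernel_socle_series:
  "congruence_kernel (socle_series B k) B"
proof (induction k)
  case 0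
  show ?case by (simp add: congruence_kernel_one)
next
  case (Suc k)
  then show ?case
    unfolding socle_series_Suc by (rule congruence_kernel.congruence_kernel_socle_above)
qed


section \<open>Right nilpotency\<close>

lemma set_splusI: "\<lbrakk>x \<in> X; y \<in> Y\<rbrakk> \<Longrightarrow> x \<boxplus>\<^bsub>B\<^esub> y \<in> set_splus B X Y"
  by (auto simp: set_splus_def)

lemma set_splus_mono: "X \<subseteq> X' \<Longrightarrow> set_splus B X Y \<subseteq> set_splus B X' Y"
  by (auto simp: set_splus_def)

context left_semi_brace
begin

lemma set_splus_idem_one: "set_splus B {\<one>} (idem B) = idem B"
  by (force simp: set_splus_def one_splus idem_closed)

lemma idem_subset_set_splus_dot: "idem B \<subseteq> set_splus B (set_dot B X Y) (idem B)"
proof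
  fix e assume e: "e \<in> idem B"
  have "\<one> \<in> set_dot B X Y"
    using generate.one[of "add_group B"] by (simp add: set_dot_def add_group_def)
  then have "\<one> \<boxplus> e \<in> set_splus B (set_dot B X Y) (idem B)"
    using e by (rule set_splusI)
  then show "e \<in> set_splus B (set_dot B X Y) (idem B)"
    using e by (simp add: one_splus idem_closed)
qed

lemma idem_subset_right_series: "idem B \<subseteq> right_series B (Suc m)"
  by (cases m) (auto simp: idem_closed dest: subsetD[OF idem_subset_set_splus_dot])

lemma idem_subset_left_series: "idem B \<subseteq> left_series B (Suc m)"
  by (cases m) (auto simp: idem_closed dest: subsetD[OF idem_subset_set_splus_dot])

lemma set_dot_subset:
  assumes "subgroup H (add_group B)" "\<And>x y. x \<in> X \<Longrightarrow> y \<in> Y \<Longrightarrow> dot B x y \<in> H"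
  shows "set_dot B X Y \<subseteq> H"
  unfolding set_dot_def
  using assms by (intro group.generate_subgroup_incl[OF group_add_group]) auto

text \<open>
  The value of \<open>x \<cdot> y\<close> depends on the projections \<open>x + 0\<close> and \<open>y + 0\<close> only. The right factor is treated
  here, and the left one in the next lemma.
\<close>

lemma dot_splus_idem_right:
  assumes "b \<in> carrier B" "x \<in> carrier B" "e \<in> idem B"
  shows "dot B b (x \<boxplus> e) = dot B b x"
proof -
  note c = assms idem_closed[OF assms(3)]
  have "x \<boxplus> e \<boxplus> lam B (x \<boxplus> e) (inv (x \<boxplus> e)) = x \<boxplus> e \<boxplus> lam B x (inv x)"
    using c by (simp add: splus_lam_inv splus_closed splus_assoc idem_splus lam_closed)
  then have "lam B (x \<boxplus> e) (inv (x \<boxplus> e)) = lam B x (inv x)"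
    by (rule splus_left_cancel[rotated -1]) (use c in \<open>auto simp: splus_closed lam_closed\<close>)
  then show ?thesis
    using c by (simp add: dot_eq splus_closed lam_splus splus_assoc lam_closed idem_splus lam_idem)
qed

text \<open>
  For the left factor this needs \<open>E\<close> to be normal: then \<open>e \<circ> b = b \<circ> h\<close> with \<open>h \<in> E\<close>, so that
  \<open>\<lambda>\<^sub>e(b)\<close> and \<open>b\<close> differ by a right summand from \<open>E\<close>.
\<close>

lemma dot_splus_idem_left:
  assumes E: "idem B \<lhd> B" and b: "b \<in> carrier B" and x: "x \<in> carrier B" and e: "e \<in> idem B"
  shows "dot B (x \<boxplus> e) b = dot B x b"
proof -
  interpret E: normal "idem B" B by fact
  define f where "f = lam B (inv x) e"
  have f: "f \<in> idem B" "f \<in> carrier B" "x \<boxplus> e = x \<otimes> f"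
    using x e by (auto simp: f_def lam_idem idem_closed splus_eq_mult lam_closed)
  define h where "h = inv b \<otimes> f \<otimes> b"
  have h: "h \<in> idem B" "h \<in> carrier B"
    using b f E.inv_op_closed1 by (auto simp: h_def)
  have "lam B f b = f \<boxplus> lam B f b"
    using b f by (simp add: idem_splus lam_closed)
  also have "\<dots> = f \<otimes> b"
    using b f by (simp add: mult_eq_splus)
  also have "\<dots> = b \<otimes> h"
    using b f by (simp add: h_def m_assoc[symmetric])
  also have "\<dots> = b \<boxplus> lam B b h"
    using b h by (simp add: mult_eq_splus)
  finally have "lam B (x \<boxplus> e) b = lam B x b \<boxplus> lam B x (lam B b h)"
    using b x f h by (simp add: lam_mult lam_splus lam_closed)
  then show ?thesis
    using b x e h by (simp add: dot_eq splus_closed splus_assoc lam_closed idem_splus lam_idem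
        idem_closed)
qed

lemma nilpotent_imp_socle_series_idem:
  assumes "ann_series B n = carrier B"
  shows "carrier B \<subseteq> set_splus B (socle_series B n \<inter> carrier (add_group B)) (idem B)"
proof
  interpret S: congruence_kernel "socle_series B n" B by (rule congruence_kernel_socle_series)
  fix b assume "b \<in> carrier B"
  then have "b \<in> ann_series B n" using assms by simp
  then obtain x e where x: "x \<in> socle_series B n" and e: "e \<in> idem B" and b: "b = x \<boxplus> e"
    by (auto simp: ann_series_def set_splus_def)
  have c: "x \<in> carrier B" "e \<in> carrier B"
    using x e S.subset by (auto simp: idem_closed)
  have "b = (x \<boxplus> \<one>) \<boxplus> e"
    using c by (simp add: b splus_assoc one_splus)
  moreover have "x \<boxplus> \<one> \<in> socle_series B n \<inter> carrier (add_group B)"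
    using x c by (auto intro: S.splus_mem splus_one_add_group)
  ultimately show "b \<in> set_splus B (socle_series B n \<inter> carrier (add_group B)) (idem B)"
    using e by (auto intro: set_splusI)
qed

lemma right_series_subset:
  assumes E: "idem B \<lhd> B" and n: "ann_series B n = carrier B" and "m \<le> n"
  shows "right_series B (Suc m)
    \<subseteq> set_splus B (socle_series B (n - m) \<inter> carrier (add_group B)) (idem B)"
  using \<open>m \<le> n\<close>
proof (induction m)
  case 0
  then show ?case using nilpotent_imp_socle_series_idem[OF n] by simp
next
  case (Suc m)
  let ?I = "socle_series B (n - Suc m)"
  interpret I: congruence_kernel ?I B by (rule congruence_kernel_socle_series)
  have above: "socle_series B (n - m) = socle_above B ?I"
    using Suc.prems socle_series_Suc[of "n - Suc m"] by (simp add: Suc_diff_Suc)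
  have "set_dot B (right_series B (Suc m)) (carrier B) \<subseteq> ?I \<inter> carrier (add_group B)"
  proof (rule set_dot_subset[OF I.subgroup_kernel_add_group])
    fix y b assume y: "y \<in> right_series B (Suc m)" and b: "b \<in> carrier B"
    obtain x e where x: "x \<in> socle_above B ?I" and e: "e \<in> idem B" and "y = x \<boxplus> e"
      using y Suc by (auto simp: above set_splus_def)
    moreover have xc: "x \<in> carrier B" using I.socle_aboveD[OF x] by simp
    ultimately have "dot B y b = dot B x b"
      using dot_splus_idem_left[OF E b xc e] by simp
    then show "dot B y b \<in> ?I \<inter> carrier (add_group B)"
      using I.dot_socle_above_left[OF x b] dot_add_group[OF xc b] by simp
  qed
  then show ?case by (simp add: set_splus_mono)
qed

lemma right_nilpotent_if_nilpotent:
  assumes E: "idem B \<lhd> B" and n: "ann_series B n = carrier B"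
  shows "right_nilpotent B"
proof -
  have "right_series B (Suc n)
      \<subseteq> set_splus B (socle_series B 0 \<inter> carrier (add_group B)) (idem B)"
    using right_series_subset[OF E n, of n] by simp
  also have "\<dots> \<subseteq> set_splus B {\<one>} (idem B)"
    by (rule set_splus_mono) simp
  finally have "right_series B (Suc n) \<subseteq> set_splus B {\<one>} (idem B)" .
  then have "right_series B (Suc n) = idem B"
    using idem_subset_right_series[of n] unfolding set_splus_idem_one by blast
  then show ?thesis
    unfolding right_nilpotent_def by blast
qed

end


section \<open>Left nilpotency\<close>

context congruence_kernel
begin

text \<open>
  A central chain of \<open>(B, \<circ>)\<close> modulo \<open>E \<circ> I\<close>. It starts at \<open>E \<circ> I\<close> rather than at the
  identity because \<open>(B, \<circ>)\<close> need only be nilpotent modulo \<open>E\<close>.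
\<close>

definition central_chain :: "nat \<Rightarrow> 'a set" where
  "central_chain j = upper_central B j <#> (idem B <#> I)"

lemma normal_central_chain:
  assumes "idem B \<lhd> B"
  shows "central_chain j \<lhd> B"
  unfolding central_chain_def
  using assms normal_upper_central normal_axioms by (intro normal_subgroup_set_mult_closed)

lemma kernel_subset_central_chain: "I \<subseteq> central_chain j"
proof
  fix x assume x: "x \<in> I"
  have "\<one> \<in> upper_central B j"
    using normal_imp_subgroup[OF normal_upper_central] subgroup.one_closed by blast
  moreover have "\<one> \<otimes> x \<in> idem B <#> I"
    using x one_idem unfolding set_mult_def by blast
  ultimately have "\<one> \<otimes> (\<one> \<otimes> x) \<in> central_chain j"
    unfolding central_chain_def set_mult_def by blast
  then show "x \<in> central_chain j"
    using x subset by auto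
qed

text \<open>Membership in \<open>central_chain j\<close> depends on the coset of \<open>I\<close> only.\<close>

lemma central_chain_coset:
  assumes E: "idem B \<lhd> B" and y: "y \<in> central_chain j"
    and x: "x \<in> carrier B" and eq: "I #> x = I #> y"
  shows "x \<in> central_chain j"
proof -
  interpret T: normal "central_chain j" B by (rule normal_central_chain[OF E])
  have yc: "y \<in> carrier B" using y T.subset by auto
  have "x \<otimes> inv y \<in> central_chain j"
    using eq x yc kernel_subset_central_chain by (auto simp: rcos_eq_iff)
  then have "x \<otimes> inv y \<otimes> y \<in> central_chain j"
    using y by (rule T.m_closed)
  then show ?thesis
    using x yc by (simp add: m_assoc)
qed

text \<open>
  The central chain cut down to the next socle term inside \<open>G\<close>. Modulo \<open>I\<close> the additions and the
  products agree there, which is why each layer is a subgroup of \<open>(G, +)\<close>.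
\<close>

abbreviation central_layer :: "nat \<Rightarrow> 'a set" where
  "central_layer j \<equiv> socle_above B I \<inter> carrier (add_group B) \<inter> central_chain j"

lemma subgroup_central_layer:
  assumes E: "idem B \<lhd> B"
  shows "subgroup (central_layer j) (add_group B)"
proof -
  interpret A: group "add_group B" by (rule group_add_group)
  interpret J: congruence_kernel "socle_above B I" B by (rule congruence_kernel_socle_above)
  interpret S: subgroup "socle_above B I \<inter> carrier (add_group B)" "add_group B"
    by (rule J.subgroup_kernel_add_group)
  interpret T: normal "central_chain j" B by (rule normal_central_chain[OF E])
  show ?thesis
  proof (rule A.subgroupI)
    have "\<one> \<in> central_layer j"
      using S.one_closed T.one_closed by (simp add: add_group_def)
    then show "central_layer j \<noteq> {}" by blast
  next
    fix a assume a: "a \<in> central_layer j"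
    have "I #> inv\<^bsub>add_group B\<^esub> a = I #> inv a"
      using a by (simp add: inv_add_group lam_inv_socle_above)
    then have "inv\<^bsub>add_group B\<^esub> a \<in> central_chain j"
      by (rule central_chain_coset[OF E T.m_inv_closed, rotated -1])
         (use a S.m_inv_closed[of a] J.subset in auto)
    then show "inv\<^bsub>add_group B\<^esub> a \<in> central_layer j"
      using S.m_inv_closed[of a] a by auto
  next
    fix a b assume a: "a \<in> central_layer j" and b: "b \<in> central_layer j"
    have "I #> (a \<boxplus> b) = I #> (a \<otimes> b)"
      using a b J.subset by (intro mult_socle_above) auto
    then have "a \<boxplus> b \<in> central_chain j"
      by (rule central_chain_coset[OF E T.m_closed, rotated -1])
         (use a b J.subset in \<open>auto intro: splus_closed\<close>)
    then show "a \<otimes>\<^bsub>add_group B\<^esub> b \<in> central_layer j"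
      using S.m_closed[of a b] a b by (simp add: add_group_def)
  qed auto
qed

text \<open>
  Modulo \<open>I\<close>, the element \<open>b \<cdot> x\<close> is the commutator of \<open>b\<close> and \<open>x\<close> in \<open>(B, \<circ>)\<close>.
\<close>

lemma dot_central_layer:
  assumes E: "idem B \<lhd> B" and x: "x \<in> central_layer (Suc j)" and b: "b \<in> carrier B"
  shows "dot B b x \<in> central_layer j"
proof -
  interpret J: congruence_kernel "socle_above B I" B by (rule congruence_kernel_socle_above)
  have xc: "x \<in> carrier B" using x J.subset by auto
  have "b \<otimes> x \<otimes> inv b \<otimes> inv x \<in> central_chain j"
    unfolding central_chain_def
  proof (rule commutator_set_mult_normal[OF _ normal_upper_central _ _ b])
    show "upper_central B (Suc j) \<subseteq> carrier B" by auto
    show "idem B <#> I \<lhd> B"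
      using E normal_axioms by (rule normal_subgroup_set_mult_closed)
    show "x \<in> upper_central B (Suc j) <#> (idem B <#> I)"
      using x unfolding central_chain_def by blast
  qed (use b upper_central_commutator in blast)
  moreover have "I #> dot B b x = I #> (b \<otimes> x \<otimes> inv b \<otimes> inv x)"
    using x b by (intro dot_socle_above_right) auto
  ultimately have "dot B b x \<in> central_chain j"
    using b xc by (metis central_chain_coset[OF E] dot_closed)
  then show ?thesis
    using J.dot_mem_right[of b x] dot_add_group[OF b xc] x b by auto
qed

text \<open>
  The bottom layer drops into \<open>I\<close>: modulo \<open>I\<close>, an element of \<open>G\<close> that is congruent to some
  \<open>e \<in> E\<close> is congruent to \<open>e + 0 = 0\<close>.
\<close>

lemma central_layer_0: "central_layer 0 \<subseteq> I \<inter> carrier (add_group B)"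
proof
  fix x assume x: "x \<in> central_layer 0"
  have one: "x \<boxplus> \<one> = x" "x \<in> carrier B" using x by (auto simp: carrier_add_group_iff)
  obtain e i where e: "e \<in> idem B" "e \<in> carrier B" and i: "i \<in> I" "i \<in> carrier B"
    and xe: "x = e \<otimes> i"
    using x subset by (auto simp: central_chain_def set_mult_def idem_closed)
  have "x \<otimes> inv e \<in> I"
    using e i by (simp add: xe inv_op_closed2)
  then have "I #> (x \<boxplus> \<one>) = I #> (e \<boxplus> \<one>)"
    using e one by (intro coset_splus_cong) (auto simp: rcos_eq_iff)
  then have "x \<in> I"
    using one e by (simp add: idem_splus coset_one coset_eq_kernel_iff)
  then show "x \<in> I \<inter> carrier (add_group B)"
    using x by simp
qed

text \<open>
  If \<open>x = z + e\<close> with \<open>z \<in> \<zeta>\<^sub>n\<close> and \<open>e \<in> E\<close>, then \<open>x = z \<circ> \<lambda>\<^sub>u(e)\<close>, where \<open>u\<close> is the inverse of \<open>z\<close>.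
  So \<open>B = \<zeta>\<^sub>n \<circ> E\<close>, and the central chain reaches all of \<open>B\<close>.
\<close>

lemma central_layer_top:
  assumes n: "ann_series B n = carrier B"
  shows "socle_above B I \<inter> carrier (add_group B) \<subseteq> central_layer n"
proof -
  have "x \<in> central_chain n" if x: "x \<in> carrier B" for x
  proof -
    have "x \<in> ann_series B n" using x n by simp
    then obtain z e where z: "z \<in> upper_central B n" and e: "e \<in> idem B" and xz: "x = z \<boxplus> e"
      by (auto simp: ann_series_def set_splus_def)
    have zc: "z \<in> carrier B"
      using z normal_imp_subgroup[OF normal_upper_central] subgroup.subset by blast
    have f: "lam B (inv z) e \<in> idem B" using zc e by (simp add: lam_idem)
    have "x = z \<otimes> (lam B (inv z) e \<otimes> \<one>)"
      using zc e by (simp add: xz splus_eq_mult idem_closed lam_closed)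
    then show ?thesis
      using z f one_closed unfolding central_chain_def set_mult_def by blast
  qed
  then show ?thesis
    by (auto simp: carrier_add_group_iff)
qed

end

context left_semi_brace
begin

lemma left_series_step:
  assumes H: "H \<subseteq> carrier B" and H': "subgroup H' (add_group B)"
    and dot: "\<And>b x. b \<in> carrier B \<Longrightarrow> x \<in> H \<Longrightarrow> dot B b x \<in> H'"
    and L: "left_series B (Suc m) \<subseteq> set_splus B H (idem B)"
  shows "left_series B (Suc (Suc m)) \<subseteq> set_splus B H' (idem B)"
proof -
  have "set_dot B (carrier B) (left_series B (Suc m)) \<subseteq> H'"
  proof (rule set_dot_subset[OF H'])
    fix b y assume b: "b \<in> carrier B" and "y \<in> left_series B (Suc m)"
    then obtain x e where "x \<in> H" "e \<in> idem B" "y = x \<boxplus> e"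
      using L by (auto simp: set_splus_def)
    then show "dot B b y \<in> H'"
      using b H dot dot_splus_idem_right[of b x e] by auto
  qed
  then show ?thesis by (simp add: set_splus_mono)
qed

text \<open>On a factor of the socle series, the chain \<open>central_layer\<close> is exhausted in \<open>n\<close> steps.\<close>

lemma left_series_descend:
  assumes E: "idem B \<lhd> B" and n: "ann_series B n = carrier B"
    and L: "left_series B (Suc m)
      \<subseteq> set_splus B (socle_series B (Suc k) \<inter> carrier (add_group B)) (idem B)"
  shows "left_series B (Suc (m + n))
      \<subseteq> set_splus B (socle_series B k \<inter> carrier (add_group B)) (idem B)"
proof -
  interpret I: congruence_kernel "socle_series B k" B by (rule congruence_kernel_socle_series)
  have "left_series B (Suc (m + i)) \<subseteq> set_splus B (I.central_layer (n - i)) (idem B)"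
    if "i \<le> n" for i
    using that
  proof (induction i)
    case 0
    note L
    also have "set_splus B (socle_series B (Suc k) \<inter> carrier (add_group B)) (idem B)
        \<subseteq> set_splus B (I.central_layer n) (idem B)"
      unfolding socle_series_Suc by (rule set_splus_mono[OF I.central_layer_top[OF n]])
    finally show ?case by (simp only: add_0_right diff_zero)
  next
    case (Suc i)
    have "left_series B (Suc (Suc (m + i))) \<subseteq> set_splus B (I.central_layer (n - Suc i)) (idem B)"
    proof (rule left_series_step[OF _ I.subgroup_central_layer[OF E]])
      show "left_series B (Suc (m + i)) \<subseteq> set_splus B (I.central_layer (n - i)) (idem B)"
        using Suc.prems by (intro Suc.IH) simp
      show "I.central_layer (n - i) \<subseteq> carrier B"
        by (auto simp: carrier_add_group_iff)
      have "n - i = Suc (n - Suc i)" using Suc.prems by simp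
      then show "dot B b x \<in> I.central_layer (n - Suc i)"
        if "b \<in> carrier B" "x \<in> I.central_layer (n - i)" for b x
        using that I.dot_central_layer[OF E, of x "n - Suc i" b] by (simp only:)
    qed
    then show ?case by (simp only: add_Suc_right)
  qed
  from this[of n] have "left_series B (Suc (m + n)) \<subseteq> set_splus B (I.central_layer 0) (idem B)"
    by (simp only: order_refl diff_self_eq_0)
  also have "\<dots> \<subseteq> set_splus B (socle_series B k \<inter> carrier (add_group B)) (idem B)"
    by (rule set_splus_mono[OF I.central_layer_0])
  finally show ?thesis .
qed

lemma left_nilpotent_if_nilpotent:
  assumes E: "idem B \<lhd> B" and n: "ann_series B n = carrier B"
  shows "left_nilpotent B"
proof -
  have "left_series B (Suc (i * n))
      \<subseteq> set_splus B (socle_series B (n - i) \<inter> carrier (add_group B)) (idem B)"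
    if "i \<le> n" for i
    using that
  proof (induction i)
    case 0
    show ?case using nilpotent_imp_socle_series_idem[OF n] by simp
  next
    case (Suc i)
    then have "n - i = Suc (n - Suc i)" by simp
    then show ?case
      using left_series_descend[OF E n, of "i * n" "n - Suc i"] Suc by (simp add: add.commute)
  qed
  from this[of n] have "left_series B (Suc (n * n))
      \<subseteq> set_splus B (socle_series B 0 \<inter> carrier (add_group B)) (idem B)"
    by simp
  also have "\<dots> \<subseteq> set_splus B {\<one>} (idem B)"
    by (rule set_splus_mono) simp
  finally have "left_series B (Suc (n * n)) \<subseteq> set_splus B {\<one>} (idem B)" .
  then have "left_series B (Suc (n * n)) = idem B"
    using idem_subset_left_series[of "n * n"] unfolding set_splus_idem_one by blast
  then show ?thesis
    unfolding left_nilpotent_def by blast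
qed

end

theorem theorem54:
  fixes B :: "('a, 'b) semi_brace_scheme"
  assumes "left_semi_brace B"
    and "nilpotent_semi_brace B"
    and "semi_brace_ideal (idem B) B"
  shows "right_nilpotent B \<and>
    (finite (carrier (add_group B)) \<and> nilpotent_group (add_group B) \<longrightarrow> left_nilpotent B)"
proof -
  interpret left_semi_brace B by fact
  obtain n where n: "ann_series B n = carrier B"
    using assms(2) by (auto simp: nilpotent_semi_brace_def)
  have E: "idem B \<lhd> B"
    using assms(3) by (simp add: semi_brace_ideal_def)
  show ?thesis
    using right_nilpotent_if_nilpotent[OF E n] left_nilpotent_if_nilpotent[OF E n] by simp
qed

end
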